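(* Let $G=\mathbb{Z}_{n_1}\times\cdots\times\mathbb{Z}_{n_\ell}$ and $M=\operatorname{lcm}(n_1,\dots,n_\ell)$. Let $E\subseteq G$ with $|E|=n$, and let $B\subseteq\widehat G$ be such that $(E,B)$ is a basis pair. Then $D_E(B)\ge n^{n(1-\varphi(M))/2}$, and consequently $\rho_E(B)<4n^{n\varphi(M)}$, where $\varphi$ is Euler's totient function.
   Context: $\widehat G$ is the group of characters $G\to\mathbb{S}^1$. For $E=\{x_1,\dots,x_n\}\subseteq G$ and $B=\{b_1,\dots,b_n\}\subseteq\widehat G$ nonempty of equal size, $T(E,B)$ is the $n\times n$ matrix with $(i,j)$ entry $b_j(x_i)$. $(E,B)$ is a basis pair if $T(E,B)$ is invertible. $D_E(B)=|\det T(E,B)|$ and $\rho_E(B)=\|T(E,B)\|^2\|T(E,B)^{-1}\|^2$ (operator $2$-norm; $\infty$ if singular). *)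

theory Defs
  imports
    "HOL-Analysis.Analysis"
    "HOL-Algebra.Product_Groups"
    "HOL-Number_Theory.Totient"
begin

definition circle_group :: "complex monoid" where
  "circle_group = \<lparr>carrier = {z. norm z = 1}, monoid.mult = (*), one = 1\<rparr>"

(* Characters are made extensional (undefined outside the carrier of G), so that equality
   of characters, and hence the size of a set of characters, is determined on G alone. *)
definition character_group :: "('g, 'm) monoid_scheme \<Rightarrow> ('g \<Rightarrow> complex) monoid" where
  "character_group G =
    \<lparr>carrier = hom G circle_group \<inter> extensional (carrier G),
     monoid.mult = (\<lambda>\<phi> \<psi>. \<lambda>g\<in>carrier G. \<phi> g * \<psi> g),
     one = (\<lambda>g\<in>carrier G. 1)\<rparr>"

lemma comm_group_character_group:
  assumes "group G"
  shows "comm_group (character_group G)"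
proof -
  interpret group G by fact
  show ?thesis
  proof (rule comm_groupI)
    fix \<phi> assume \<phi>: "\<phi> \<in> carrier (character_group G)"
    then have "(\<lambda>g\<in>carrier G. inverse (\<phi> g)) \<in> carrier (character_group G)"
      by (auto simp: character_group_def circle_group_def hom_def Pi_iff norm_inverse)
    moreover have "\<phi> g \<noteq> 0" if "g \<in> carrier G" for g
      using \<phi> that by (force simp: character_group_def circle_group_def hom_def Pi_iff)
    then have "(\<lambda>g\<in>carrier G. inverse (\<phi> g)) \<otimes>\<^bsub>character_group G\<^esub> \<phi> = \<one>\<^bsub>character_group G\<^esub>"
      by (auto simp: character_group_def restrict_def)
    ultimately show "\<exists>\<psi>\<in>carrier (character_group G).
        \<psi> \<otimes>\<^bsub>character_group G\<^esub> \<phi> = \<one>\<^bsub>character_group G\<^esub>" by blast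
  qed (auto simp: character_group_def circle_group_def hom_def Pi_iff norm_mult restrict_def
        extensional_def fun_eq_iff mult_ac)
qed

(* The index type 'n plays the role of {1..n}: x and b are enumerations of E and B.
   Renumbering E or B only permutes rows or columns. *)
definition eval_matrix :: "('n \<Rightarrow> 'g) \<Rightarrow> ('n \<Rightarrow> 'g \<Rightarrow> complex) \<Rightarrow> complex ^ 'n ^ 'n::finite" where
  "eval_matrix x b = (\<chi> i j. b j (x i))"

definition basis_pair :: "('n::finite \<Rightarrow> 'g) \<Rightarrow> ('n \<Rightarrow> 'g \<Rightarrow> complex) \<Rightarrow> bool" where
  "basis_pair x b \<longleftrightarrow> invertible (eval_matrix x b)"

definition abs_det :: "('n::finite \<Rightarrow> 'g) \<Rightarrow> ('n \<Rightarrow> 'g \<Rightarrow> complex) \<Rightarrow> real" where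
  "abs_det x b = norm (det (eval_matrix x b))"

definition cond_sq :: "('n::finite \<Rightarrow> 'g) \<Rightarrow> ('n \<Rightarrow> 'g \<Rightarrow> complex) \<Rightarrow> ereal" where
  "cond_sq x b =
    (if invertible (eval_matrix x b)
     then ereal ((onorm ((*v) (eval_matrix x b)))\<^sup>2 * (onorm ((*v) (matrix_inv (eval_matrix x b))))\<^sup>2)
     else \<infinity>)"

end

theory Submission
  imports "Jordan_Normal_Form.Char_Poly" Defs
begin

text \<open>
  Every entry of \<open>T(E,B)\<close> is a power of \<open>z = exp (2 \<pi> i / M)\<close>, so \<open>det T(E,B) = p(z)\<close> for an integer
  polynomial \<open>p\<close>. The product of \<open>p(r)\<close> over the roots \<open>r\<close> of the minimal polynomial of \<open>z\<close> is a nonzero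
  integer. There are at most \<open>\<phi>(M)\<close> such roots, all of them \<open>M\<close>-th roots of unity, so each other factor is
  the determinant of an \<open>n \<times> n\<close> matrix with unimodular entries, which Hadamard's inequality bounds
  by \<open>n\<^bsup>n/2\<^esup>\<close>. This bounds \<open>p(z)\<close> from below; that the minimal polynomial has
  degree exactly \<open>\<phi>(M)\<close> is not needed. The condition number is then controlled by the
  Guggenheimer--Edelman--Johnson inequality, a bound in terms of \<open>|det|\<close> and the Frobenius norm.
\<close>

no_notation vec_index (infixl "$" 100)

section \<open>Integer polynomials at roots of unity\<close>

abbreviation ipoly :: "int poly \<Rightarrow> complex \<Rightarrow> complex" where
  "ipoly p \<equiv> poly (of_int_poly p)"

text \<open>By pseudo-division, a nonzero annihilator of least degree divides every other one up to
  scaling. Gauss's lemma removes the scaling, and the monic \<open>f\<close> forces a leading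
  coefficient of 1 or -1.\<close>

lemma int_minimal_poly_exists:
  assumes f: "lead_coeff f = 1" "ipoly f z = 0"
  obtains m where "lead_coeff m = 1" "ipoly m z = 0" "\<And>q. ipoly q z = 0 \<Longrightarrow> m dvd q"
proof -
  define P where "P q \<longleftrightarrow> q \<noteq> 0 \<and> ipoly q z = 0" for q
  have "P f" using f by (auto simp: P_def)
  define g where "g = (ARG_MIN degree q. P q)"
  have g: "P g" and min: "\<And>q. P q \<Longrightarrow> degree g \<le> degree q"
    using arg_min_nat_lemma[of P f degree] \<open>P f\<close> by (auto simp: g_def)
  have dvd: "primitive_part g dvd q" if q: "ipoly q z = 0" for q
  proof -
    from g have "g \<noteq> 0" by (simp add: P_def)
    from pseudo_mod[OF this, of q] obtain a t where
      a: "a \<noteq> 0" "Polynomial.smult a q = g * t + pseudo_mod q g"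
      and r: "pseudo_mod q g = 0 \<or> degree (pseudo_mod q g) < degree g" by blast
    have "ipoly (Polynomial.smult a q) z = ipoly (g * t + pseudo_mod q g) z" using a by simp
    then have "ipoly (pseudo_mod q g) z = 0"
      using q g by (simp add: hom_distribs P_def)
    then have "pseudo_mod q g = 0"
      using r min[of "pseudo_mod q g"] unfolding P_def by (meson leD)
    \<comment> \<open>Primitive parts are multiplicative, so the factor \<open>a\<close> of
      pseudo-division shrinks to its sign.\<close>
    with a have "primitive_part (Polynomial.smult a q) = primitive_part g * primitive_part t"
      by (simp add: primitive_part_mult)
    then have "Polynomial.smult (unit_factor a) (primitive_part q) = primitive_part g * primitive_part t"
      by (simp add: primitive_part_smult)
    then have "primitive_part g dvd Polynomial.smult (unit_factor a) (primitive_part q)" by simp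
    moreover have "unit_factor a = 1 \<or> unit_factor a = -1" using a by (simp add: sgn_if)
    ultimately have "primitive_part g dvd primitive_part q" by auto
    then show ?thesis
      by (metis content_times_primitive_part dvd_smult)
  qed
  obtain h where h: "f = primitive_part g * h" using dvd[OF f(2)] by (auto elim: dvdE)
  then have lc: "lead_coeff (primitive_part g) * lead_coeff h = 1"
    using f by (simp add: lead_coeff_mult)
  define c where "c = lead_coeff (primitive_part g)"
  have "c = 1 \<or> c = -1" using lc zmult_eq_1_iff by (auto simp: c_def)
  then have cc: "c * c = 1" by auto
  define m where "m = Polynomial.smult c (primitive_part g)"
  have "Polynomial.smult (Polynomial.content g * c) m = Polynomial.smult (Polynomial.content g * (c * c)) (primitive_part g)"
    by (simp only: m_def smult_smult mult.assoc)
  then have gm: "g = Polynomial.smult (Polynomial.content g * c) m"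
    by (simp only: cc mult_1_right content_times_primitive_part)
  show thesis
  proof (rule that)
    show "lead_coeff m = 1" by (simp only: m_def lead_coeff_smult cc flip: c_def)
    have "ipoly g z = 0" "g \<noteq> 0" using g by (simp_all add: P_def)
    then show "ipoly m z = 0" using cc
      by (subst (asm) gm) (auto simp: hom_distribs)
    show "m dvd q" if "ipoly q z = 0" for q
    proof -
      from dvd[OF that] obtain k where "q = primitive_part g * k" by (auto elim: dvdE)
      then have "q = m * Polynomial.smult c k" by (simp add: m_def cc mult.assoc[symmetric])
      then show ?thesis by (rule dvdI)
    qed
  qed
qed

text \<open>\<open>m\<close> is irreducible: the minimal polynomial \<open>g\<close> of
  \<open>r\<close> divides \<open>m\<close>, and if the cofactor vanished at \<open>z\<close>, then
  \<open>g\<close> would be a unit although it vanishes at \<open>r\<close>. Hence \<open>m\<close>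
  divides \<open>g\<close>, which divides \<open>q\<close>.\<close>

lemma int_minimal_poly_conjugate:
  assumes m: "lead_coeff m = 1" "ipoly m z = 0" "\<And>q. ipoly q z = 0 \<Longrightarrow> m dvd q"
    and r: "ipoly m r = 0" "ipoly q r = 0"
  shows "m dvd q"
proof -
  obtain g where g: "lead_coeff g = 1" "ipoly g r = 0" "\<And>q. ipoly q r = 0 \<Longrightarrow> g dvd q"
    using int_minimal_poly_exists[OF m(1) r(1)] by blast
  obtain h where h: "m = g * h" using g(3)[OF r(1)] by (auto elim: dvdE)
  then have "ipoly g z * ipoly h z = 0" using m(2) by (simp add: hom_distribs)
  then consider "m dvd g" | "m dvd h" using m(3) by auto
  then show ?thesis
  proof cases
    case 1
    then show ?thesis using g(3)[OF r(2)] by (rule dvd_trans)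
  next
    case 2
    then obtain k where "h = m * k" by (auto elim: dvdE)
    with h have "m * (g * k) = m * 1" by (simp add: mult_ac)
    then have "g * k = 1" using m(1) by (subst (asm) mult_cancel_left) auto
    then have "ipoly (g * k) r = 1" by simp
    with g(2) show ?thesis by (simp add: hom_distribs)
  qed
qed

text \<open>
  On the Vandermonde basis the diagonal matrix of the values \<open>p(r)\<close> becomes the integer matrix of
  multiplication by \<open>p\<close> modulo \<open>m\<close>.
\<close>

lemma prod_ipoly_roots_Ints:
  assumes m: "lead_coeff m = 1" and card: "card {r. ipoly m r = 0} = degree m"
  shows "(\<Prod>r | ipoly m r = 0. ipoly p r) \<in> \<int>"
proof -
  define d where "d = degree m"
  define R where "R = {r. ipoly m r = 0}"
  have m0: "m \<noteq> 0" using m by auto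
  then have "finite R" unfolding R_def by (intro poly_roots_finite) simp
  then obtain \<rho> where \<rho>: "bij_betw \<rho> {0..<d} R"
    using ex_bij_betw_nat_finite[of R] card by (auto simp: R_def d_def)
  \<comment> \<open>Since \<open>m\<close> is monic, pseudo-division is true division with
    remainder.\<close>
  define rem where "rem j = snd (pseudo_divmod (p * monom 1 j) m)" for j
  have rem: "ipoly (rem j) r = ipoly p r * r ^ j" if "r \<in> R" for r j
  proof -
    obtain q where q: "pseudo_divmod (p * monom 1 j) m = (q, rem j)"
      by (metis rem_def prod.collapse)
    have "p * monom 1 j = m * q + rem j"
      using pseudo_divmod(1)[OF m0 q] m by simp
    then have "ipoly (p * monom 1 j) r = ipoly (m * q + rem j) r" by simp
    then show ?thesis using that by (simp add: hom_distribs R_def poly_monom)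
  qed
  have deg: "rem j = 0 \<or> degree (rem j) < d" for j
    using pseudo_divmod(2)[OF m0, of "p * monom 1 j" _ "rem j"] by (metis rem_def d_def prod.collapse)
  define V :: "complex mat" where "V = Matrix.mat d d (\<lambda>(i, j). \<rho> i ^ j)"
  define D :: "complex mat" where "D = Matrix.mat d d (\<lambda>(i, j). if i = j then ipoly p (\<rho> i) else 0)"
  define C :: "int mat" where "C = Matrix.mat d d (\<lambda>(k, j). coeff (rem j) k)"
  have carr: "V \<in> carrier_mat d d" "D \<in> carrier_mat d d" "C \<in> carrier_mat d d"
    by (simp_all add: V_def D_def C_def)
  have poly_lt: "poly q x = (\<Sum>k = 0..<d. coeff q k * x ^ k)" if "q = 0 \<or> degree q < d"
    for q :: "complex poly" and x
  proof -
    have "poly q x = (\<Sum>k\<le>degree q. coeff q k * x ^ k)" by (rule poly_altdef)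
    also have "\<dots> = (\<Sum>k = 0..<d. coeff q k * x ^ k)"
      by (cases "q = 0") (use that in \<open>auto intro!: sum.mono_neutral_left simp: coeff_eq_0\<close>)
    finally show ?thesis .
  qed
  \<comment> \<open>Column \<open>j\<close> of \<open>C\<close> holds the coefficients of
    \<open>rem j\<close>, so both sides evaluate p(x) x^j at the roots.\<close>
  have "D * V = V * map_mat of_int C"
  proof (rule eq_matI)
    fix i j assume "i < dim_row (V * map_mat of_int C)" "j < dim_col (V * map_mat of_int C)"
    then have ij: "i < d" "j < d" by (simp_all add: V_def C_def)
    then have "\<rho> i \<in> R" using \<rho> by (auto simp: bij_betw_def)
    have "(D * V) $$ (i, j) = (\<Sum>k = 0..<d. (if i = k then ipoly p (\<rho> i) else 0) * \<rho> k ^ j)"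
      using ij by (simp add: D_def V_def scalar_prod_def)
    also have "\<dots> = (\<Sum>k = 0..<d. if k = i then ipoly p (\<rho> i) * \<rho> i ^ j else 0)"
      by (intro sum.cong) auto
    also have "\<dots> = ipoly (rem j) (\<rho> i)"
      using ij rem[OF \<open>\<rho> i \<in> R\<close>] by simp
    also have "\<dots> = (\<Sum>k = 0..<d. of_int (coeff (rem j) k) * \<rho> i ^ k)"
      using deg[of j] by (subst poly_lt) auto
    also have "\<dots> = (V * map_mat of_int C) $$ (i, j)"
      using ij by (simp add: C_def V_def scalar_prod_def mult.commute)
    finally show "(D * V) $$ (i, j) = (V * map_mat of_int C) $$ (i, j)" .
  qed (simp_all add: V_def D_def C_def)
  then have "Determinant.det D * Determinant.det V = Determinant.det V * of_int (Determinant.det C)"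
    using carr by (metis Determinant.det_mult map_carrier_mat of_int_hom.hom_det)
  \<comment> \<open>A kernel vector of the Vandermonde matrix would list the coefficients of a
    nonzero polynomial of degree below \<open>d\<close> with \<open>d\<close> distinct
    roots.\<close>
  moreover have "Determinant.det V \<noteq> 0"
  proof
    assume "Determinant.det V = 0"
    then obtain v where v: "v \<in> carrier_vec d" "v \<noteq> 0\<^sub>v d" "V *\<^sub>v v = 0\<^sub>v d"
      using det_0_iff_vec_prod_zero[OF carr(1)] by blast
    define q where "q = (\<Sum>k = 0..<d. monom (vec_index v k) k)"
    have cq: "coeff q k = (if k < d then vec_index v k else 0)" for k
      by (simp add: q_def coeff_sum)
    have "q \<noteq> 0"
    proof
      assume "q = 0"
      then have "vec_index v k = 0" if "k < d" for k using cq[of k] that by simp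
      then have "v = 0\<^sub>v d" using v(1) by (intro eq_vecI) auto
      with v(2) show False by simp
    qed
    then have dq: "degree q < d"
      using cq[of "degree q"] by (metis leading_coeff_0_iff)
    have "poly q r = 0" if r: "r \<in> R" for r
    proof -
      obtain i where i: "i < d" "r = \<rho> i" using \<rho> r by (auto simp: bij_betw_def)
      have "vec_index (V *\<^sub>v v) i = 0" using v(3) i by simp
      then have "(\<Sum>k = 0..<d. \<rho> i ^ k * vec_index v k) = 0"
        using i v(1) by (simp add: V_def scalar_prod_def)
      then show ?thesis using dq i by (subst poly_lt) (auto simp: cq mult.commute)
    qed
    then have "card R \<le> card {r. poly q r = 0}"
      using \<open>q \<noteq> 0\<close> by (intro card_mono poly_roots_finite) auto
    also have "\<dots> \<le> degree q" using \<open>q \<noteq> 0\<close> by (rule card_poly_roots_bound)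
    finally show False using dq card by (simp add: R_def d_def)
  qed
  ultimately have "Determinant.det D = of_int (Determinant.det C)" by simp
  moreover have "Determinant.det D = (\<Prod>i = 0..<d. ipoly p (\<rho> i))"
    by (subst det_upper_triangular[OF _ carr(2)]) (auto simp: D_def upper_triangular_def prod_list_diag_prod)
  moreover have "(\<Prod>i = 0..<d. ipoly p (\<rho> i)) = (\<Prod>r\<in>R. ipoly p r)"
    by (rule prod.reindex_bij_betw[OF \<rho>])
  ultimately show ?thesis by (metis Ints_of_int R_def)
qed

text \<open>A nonzero integer has absolute value at least 1. Setting aside the factor at
  \<open>z\<close> leaves at most \<open>totient M - 1\<close> conjugate values, each bounded by
  \<open>H\<close>; \<open>H \<ge> 1\<close> allows the exponent to be rounded up.\<close>

lemma norm_ipoly_root_of_unity_ge: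
  fixes M :: nat and p :: "int poly"
  defines "z \<equiv> cis (2 * pi / real M)"
  assumes M: "M > 0" and pz: "ipoly p z \<noteq> 0"
    and bound: "\<And>r. r ^ M = 1 \<Longrightarrow> norm (ipoly p r) \<le> H" and H: "H \<ge> 1"
  shows "1 \<le> norm (ipoly p z) * H ^ (totient M - 1)"
proof -
  have zk: "z ^ k = cis (2 * pi * real k / real M)" for k
    by (simp add: z_def Complex.DeMoivre mult.commute)
  note bij = Complex.bij_betw_roots_unity[OF M]
  define f :: "int poly" where "f = monom 1 M - 1"
  have f_eval: "ipoly f r = r ^ M - 1" for r
    by (simp add: f_def hom_distribs poly_monom)
  have deg_f: "degree f = M"
    unfolding f_def diff_conv_add_uminus
    using M by (subst degree_add_eq_left) (auto simp: degree_monom_eq)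
  have lc_f: "lead_coeff f = 1"
    unfolding deg_f using M by (simp add: f_def)
  have "z ^ M = 1" using M by (simp add: zk)
  then have "ipoly f z = 0" by (simp add: f_eval)
  then obtain m where m: "lead_coeff m = 1" "ipoly m z = 0" "\<And>q. ipoly q z = 0 \<Longrightarrow> m dvd q"
    using int_minimal_poly_exists[OF lc_f] by blast
  define R where "R = {r. ipoly m r = 0}"
  obtain h where h: "f = m * h" using m(3)[OF \<open>ipoly f z = 0\<close>] by (auto elim: dvdE)
  have f0: "f \<noteq> 0" using lc_f by auto
  then have m0: "m \<noteq> 0" and h0: "h \<noteq> 0" using h by auto
  have R_root: "r ^ M = 1" if "r \<in> R" for r
    using that f_eval[of r] by (simp add: h hom_distribs R_def)
  have finR: "finite R" unfolding R_def using m0 by (intro poly_roots_finite) simp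
  \<comment> \<open>\<open>f\<close> has deg m + deg h distinct roots, so neither factor can have
    fewer roots than its degree.\<close>
  have cardR: "card R = degree m"
  proof -
    have "{r. ipoly f r = 0} = R \<union> {r. ipoly h r = 0}"
      by (auto simp: h hom_distribs R_def)
    then have "card {r. ipoly f r = 0} \<le> card R + card {r. ipoly h r = 0}"
      by (simp add: card_Un_le)
    moreover have "card {r. ipoly f r = 0} = M"
      using Complex.card_roots_unity_eq[OF M] by (simp add: f_eval)
    moreover have "card {r. ipoly h r = 0} \<le> degree h"
      using card_poly_roots_bound[of "of_int_poly h :: complex poly"] h0 by simp
    moreover have "card R \<le> degree m"
      using card_poly_roots_bound[of "of_int_poly m :: complex poly"] m0 by (simp add: R_def)
    moreover have "M = degree m + degree h"
      using deg_f h m0 h0 by (simp add: degree_mult_eq)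
    ultimately show ?thesis by linarith
  qed
  \<comment> \<open>If r^k = 1, then \<open>m\<close> divides x^k - 1, so z^k = 1 as well; but
    \<open>z\<close> has order exactly \<open>M\<close>.\<close>
  have primitive: "r ^ k \<noteq> 1" if "r \<in> R" "0 < k" "k < M" for r k
  proof
    assume "r ^ k = 1"
    then have "ipoly (monom 1 k - 1) r = 0" by (simp add: hom_distribs poly_monom)
    then have "m dvd monom 1 k - 1"
      using int_minimal_poly_conjugate[OF m, of r] that(1) by (simp only: R_def mem_Collect_eq)
    then obtain q where q: "monom 1 k - 1 = m * q" by (auto elim: dvdE)
    have "ipoly (monom 1 k - 1) z = 0" unfolding q using m(2) by (simp add: hom_distribs)
    then have "z ^ k = z ^ 0" by (simp add: hom_distribs poly_monom)
    then have "k = 0"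
      using inj_onD[OF bij_betw_imp_inj_on[OF bij], of k 0] that M unfolding zk by auto
    with that show False by simp
  qed
  have "R \<subseteq> (\<lambda>k. z ^ k) ` totatives M"
  proof
    fix r assume r: "r \<in> R"
    then obtain k where k: "k < M" "r = z ^ k"
      using R_root[OF r] bij unfolding bij_betw_def zk by blast
    \<comment> \<open>\<open>totatives M\<close> lies in {1..M}, so exponent 0 is traded for
      \<open>M\<close>; this matters only for M = 1.\<close>
    define k' where "k' = (if k = 0 then M else k)"
    have k': "0 < k'" "k' \<le> M" "r = z ^ k'"
      using k M \<open>z ^ M = 1\<close> by (auto simp: k'_def)
    define g where "g = gcd k' M"
    have "g > 0" using M by (simp add: g_def)
    obtain a b where ab: "k' = g * a" "M = g * b"
      by (metis g_def dvdE gcd_dvd1 gcd_dvd2)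
    \<comment> \<open>With M = g b the power r^b is already 1, so primitivity forces b = M and g =
      1.\<close>
    have "g * a * b = g * b * a" by simp
    then have "k' * b = M * a" by (simp only: ab[symmetric])
    then have "r ^ b = (z ^ M) ^ a" by (simp only: k'(3) flip: power_mult)
    then have "r ^ b = 1" using \<open>z ^ M = 1\<close> by simp
    moreover have "b > 0" using ab M by (cases b) auto
    ultimately have "\<not> b < M" using primitive[OF r] by blast
    then have "g = 1" using ab M \<open>g > 0\<close> by (cases "g = 1") (auto simp: not_less)
    then have "k' \<in> totatives M" using k' by (simp add: totatives_def g_def coprime_iff_gcd_eq_1)
    then show "r \<in> (\<lambda>k. z ^ k) ` totatives M" using k'(3) by blast
  qed
  then have "card R \<le> card ((\<lambda>k. z ^ k) ` totatives M)" by (intro card_mono) auto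
  also have "\<dots> \<le> totient M" by (simp add: totient_def card_image_le)
  finally have card_le: "card R \<le> totient M" .
  have nz: "ipoly p r \<noteq> 0" if "r \<in> R" for r
  proof
    assume "ipoly p r = 0"
    then have "m dvd p"
      using int_minimal_poly_conjugate[OF m, of r] that by (simp only: R_def mem_Collect_eq)
    then obtain q where "p = m * q" by (auto elim: dvdE)
    with pz m(2) show False by (simp add: hom_distribs)
  qed
  have zR: "z \<in> R" using m(2) by (simp add: R_def)
  have "(\<Prod>r\<in>R. ipoly p r) \<in> \<int>"
    using prod_ipoly_roots_Ints[OF m(1)] cardR by (simp add: R_def)
  moreover have "(\<Prod>r\<in>R. ipoly p r) \<noteq> 0" using nz finR by simp
  ultimately have "1 \<le> norm (\<Prod>r\<in>R. ipoly p r)"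
    by (auto elim!: Ints_cases)
  also have "\<dots> = norm (ipoly p z) * (\<Prod>r\<in>R - {z}. norm (ipoly p r))"
    using finR zR by (subst prod.remove[of _ z]) (auto simp: norm_mult prod_norm)
  also have "\<dots> \<le> norm (ipoly p z) * (\<Prod>r\<in>R - {z}. H)"
    by (intro mult_left_mono prod_mono) (auto simp: bound R_root)
  also have "\<dots> = norm (ipoly p z) * H ^ (card R - 1)" using zR finR by simp
  also have "\<dots> \<le> norm (ipoly p z) * H ^ (totient M - 1)"
    using card_le H by (intro mult_left_mono power_increasing) auto
  finally show ?thesis .
qed

section \<open>Hadamard's inequality\<close>

definition cinner :: "complex ^ 'n::finite \<Rightarrow> complex ^ 'n \<Rightarrow> complex" where
  "cinner u v = (\<Sum>i\<in>UNIV. u $ i * cnj (v $ i))"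

lemma cinner_self: "cinner u u = of_real ((norm u)\<^sup>2)"
  by (simp add: cinner_def norm_vec_def L2_set_def sum_nonneg flip: complex_norm_square)

lemma cinner_commute: "cinner v u = cnj (cinner u v)"
  by (simp add: cinner_def mult.commute)

lemma cinner_add_left: "cinner (u + v) w = cinner u w + cinner v w"
  by (simp add: cinner_def sum.distrib algebra_simps)

lemma cinner_smult_left: "cinner (c *s u) w = c * cinner u w"
  by (simp add: cinner_def sum_distrib_left algebra_simps)

lemma cinner_add_right: "cinner w (u + v) = cinner w u + cinner w v"
  by (simp add: cinner_def sum.distrib algebra_simps)

lemma cinner_smult_right: "cinner w (c *s u) = cnj c * cinner w u"
  by (simp add: cinner_def sum_distrib_left algebra_simps)

lemma cinner_zero_left [simp]: "cinner 0 w = 0"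
  by (simp add: cinner_def)

text \<open>The two cross terms are complex conjugates, hence twice a real part. This expansion
  serves the extremal arguments and every use of Pythagoras below.\<close>

lemma norm_add_smult_square:
  fixes u v :: "complex ^ 'n::finite"
  shows "(norm (u + c *s v))\<^sup>2
    = (norm u)\<^sup>2 + 2 * Re (cnj c * cinner u v) + (norm c)\<^sup>2 * (norm v)\<^sup>2"
proof -
  have "complex_of_real ((norm (u + c *s v))\<^sup>2) = cinner (u + c *s v) (u + c *s v)"
    by (simp only: cinner_self)
  also have "\<dots> = cinner u u + (cnj c * cinner u v + cnj (cnj c * cinner u v))
      + c * cnj c * cinner v v"
    by (simp add: cinner_add_left cinner_add_right cinner_smult_left cinner_smult_right
        cinner_commute[of v u] algebra_simps)
  also have "\<dots> = of_real ((norm u)\<^sup>2 + 2 * Re (cnj c * cinner u v) + (norm c)\<^sup>2 * (norm v)\<^sup>2)"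
    unfolding complex_add_cnj cinner_self complex_norm_square[symmetric] by simp
  finally show ?thesis
    by (simp only: of_real_eq_iff)
qed

lemma norm_smult_vec: "norm (c *s (v :: complex ^ 'n::finite)) = norm c * norm v"
proof -
  have "(norm (c *s v))\<^sup>2 = (norm c * norm v)\<^sup>2"
    using norm_add_smult_square[of 0 c v] by (simp add: power_mult_distrib)
  then show ?thesis by (simp add: power2_eq_iff_nonneg)
qed

section \<open>Determinants as functions of their rows\<close>

lemma continuous_on_det [continuous_intros]:
  "continuous_on S (det :: complex ^ 'n ^ 'n::finite \<Rightarrow> complex)"
  unfolding Determinants.det_def
  by (intro continuous_on_sum continuous_on_mult continuous_on_prod continuous_intros)

text \<open>Cofactor expansion, with each cofactor written as a determinant that has a basis vector
  in row \<open>i\<close>.\<close>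

lemma det_row_linear:
  fixes A :: "complex ^ 'n ^ 'n::finite" and v :: "complex ^ 'n"
  shows "det (\<chi> k. if k = i then v else A $ k)
    = (\<Sum>j\<in>UNIV. v $ j * det (\<chi> k. if k = i then axis j 1 else A $ k))"
proof -
  have "det (\<chi> k. if k = i then v else A $ k)
      = det (\<chi> k. if k = i then (\<Sum>j\<in>UNIV. v $ j *s axis j 1) else A $ k)"
    by (simp only: basis_expansion)
  also have "\<dots> = (\<Sum>j\<in>UNIV. det (\<chi> k. if k = i then v $ j *s axis j 1 else A $ k))"
    by (rule det_linear_row_sum) simp
  also have "\<dots> = (\<Sum>j\<in>UNIV. v $ j * det (\<chi> k. if k = i then axis j 1 else A $ k))"
    by (simp only: det_row_mul)
  finally show ?thesis .
qed

lemma det_cnj: "det (\<chi> i j. cnj ((A :: complex ^ 'n ^ 'n::finite) $ i $ j)) = cnj (det A)"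
  by (simp add: Determinants.det_def)

lemma norm_det_unitary:
  fixes A :: "complex ^ 'n ^ 'n::finite"
  assumes "\<And>i j. cinner (A $ i) (A $ j) = (if i = j then 1 else 0)"
  shows "norm (det A) = 1"
proof -
  define B where "B = (\<chi> i j. cnj (A $ i $ j))"
  have "A ** transpose B = mat 1"
    using assms by (simp add: B_def vec_eq_iff matrix_matrix_mult_def transpose_def mat_def cinner_def)
  then have "det A * det B = 1"
    using det_mul[of A "transpose B"] by simp
  then have "det A * cnj (det A) = 1"
    by (simp add: B_def det_cnj)
  then have "(norm (det A))\<^sup>2 = 1"
    by (metis complex_norm_square of_real_eq_1_iff)
  then show ?thesis
    by (simp add: power2_eq_1_iff) (smt (verit) norm_ge_zero)
qed

text \<open>
  A maximiser of the determinant over matrices with rows in the unit ball is unitary: the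
  determinant is linear in each row, so each row must be parallel to the conjugate of its vector
  of cofactors, which is orthogonal to the other rows.
\<close>

lemma norm_det_le_1:
  fixes A :: "complex ^ 'n ^ 'n::finite"
  assumes "\<And>i. norm (A $ i) \<le> 1"
  shows "norm (det A) \<le> 1"
proof -
  define K :: "(complex ^ 'n ^ 'n) set" where "K = {A. \<forall>i. norm (A $ i) \<le> 1}"
  have "closed K"
    unfolding K_def by (intro closed_Collect_all closed_Collect_le continuous_intros)
  moreover have "bounded K"
  proof (rule boundedI)
    fix A assume "A \<in> K"
    then have "(\<Sum>i\<in>UNIV. norm (A $ i)) \<le> (\<Sum>i\<in>(UNIV :: 'n set). 1)"
      by (intro sum_mono) (auto simp: K_def)
    moreover have "norm A \<le> (\<Sum>i\<in>UNIV. norm (A $ i))"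
      by (simp add: norm_vec_def L2_set_le_sum)
    ultimately show "norm A \<le> real CARD('n)" by simp
  qed
  ultimately have "compact K" by (simp add: compact_eq_bounded_closed)
  moreover have I_K: "mat 1 \<in> K"
    by (simp add: K_def mat_def norm_vec_def L2_set_def if_distrib[of norm]
        if_distrib[of "\<lambda>x. x\<^sup>2"] cong: if_cong)
  moreover have "continuous_on K (\<lambda>A. norm (det A))"
    by (intro continuous_intros)
  ultimately obtain X where X: "X \<in> K" and max: "\<And>Y. Y \<in> K \<Longrightarrow> norm (det Y) \<le> norm (det X)"
    using continuous_attains_sup[of K "\<lambda>A. norm (det A)"] by blast
  have D1: "norm (det X) \<ge> 1"
    using max[OF I_K] by simp
  have row: "norm (X $ i) = 1 \<and> (\<forall>k. k \<noteq> i \<longrightarrow> cinner (X $ k) (X $ i) = 0)" for i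
  proof -
    define f where "f v = det (\<chi> k. if k = i then v else X $ k)" for v
    define c where "c = (\<chi> j. cnj (f (axis j 1)))"
    have f: "f v = cinner v c" for v
      using det_row_linear[of i v X] by (simp add: f_def c_def cinner_def)
    have fi: "f (X $ i) = det X"
    proof -
      have "(\<chi> k. if k = i then X $ i else X $ k) = X" by (simp add: vec_eq_iff)
      then show ?thesis by (simp add: f_def)
    qed
    have fk: "f (X $ k) = 0" if "k \<noteq> i" for k
      unfolding f_def
      by (rule det_identical_rows[of i k]) (use that in \<open>auto simp: row_def vec_eq_iff\<close>)
    have "c \<noteq> 0"
    proof
      assume "c = 0"
      then have "det X = 0" using fi f by (simp add: cinner_def)
      with D1 show False by simp
    qed
    then have c0: "norm c > 0" by simp
    \<comment> \<open>The unit vector along \<open>c\<close> is admissible as row \<open>i\<close>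
      and gives \<open>f\<close> the value \<open>norm c\<close>, so maximality bounds
      \<open>norm c\<close> by the determinant.\<close>
    define u where "u = complex_of_real (1 / norm c) *s c"
    have "norm u = 1"
      using c0 by (simp add: u_def norm_smult_vec norm_divide)
    then have "(\<chi> k. if k = i then u else X $ k) \<in> K"
      using X by (simp add: K_def)
    then have "norm (f u) \<le> norm (det X)"
      unfolding f_def by (rule max)
    moreover have "f u = of_real (norm c)"
      using c0 by (simp add: f u_def cinner_smult_left cinner_self power2_eq_square)
    ultimately have cD: "norm c \<le> norm (det X)" by simp
    \<comment> \<open>\<open>t *s c\<close> is the orthogonal projection of row \<open>i\<close>
      onto \<open>c\<close>. Its length is at least 1 and the row has length at most 1, so the
      residual vanishes.\<close>
    define t where "t = det X / of_real ((norm c)\<^sup>2)"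
    have nt: "norm t = norm (det X) / (norm c)\<^sup>2"
      by (simp add: t_def norm_divide norm_power)
    have "(norm (X $ i + (- t) *s c))\<^sup>2
        = (norm (X $ i))\<^sup>2 - 2 * Re (cnj t * det X) + (norm t)\<^sup>2 * (norm c)\<^sup>2"
      unfolding norm_add_smult_square using f fi by simp
    also have "cnj t * det X = of_real ((norm (det X))\<^sup>2 / (norm c)\<^sup>2)"
      unfolding t_def of_real_divide complex_norm_square[of "det X"] by (simp add: mult.commute)
    also have "(norm t)\<^sup>2 * (norm c)\<^sup>2 = (norm (det X))\<^sup>2 / (norm c)\<^sup>2"
      using c0 by (simp add: nt power2_eq_square)
    also have "(norm (X $ i))\<^sup>2 - 2 * Re (of_real ((norm (det X))\<^sup>2 / (norm c)\<^sup>2))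
        + (norm (det X))\<^sup>2 / (norm c)\<^sup>2 = (norm (X $ i))\<^sup>2 - (norm (det X) / norm c)\<^sup>2"
      by (simp add: power_divide)
    also have "\<dots> \<le> 1 - 1"
    proof (rule diff_mono)
      show "(norm (X $ i))\<^sup>2 \<le> 1"
        using X by (simp add: K_def power_le_one)
      show "1 \<le> (norm (det X) / norm c)\<^sup>2"
        using cD c0 by (simp add: one_le_power)
    qed
    finally have Xi: "X $ i = t *s c" by (simp add: vec_eq_iff)
    have "norm (X $ i) = norm (det X) / norm c"
      using c0 by (simp add: Xi norm_smult_vec nt power2_eq_square)
    then have "norm (X $ i) \<ge> 1" using cD c0 by simp
    then have "norm (X $ i) = 1" using X by (simp add: K_def order_antisym)
    moreover have "cinner (X $ k) (X $ i) = 0" if "k \<noteq> i" for k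
      using fk[OF that] by (simp add: Xi cinner_smult_right f)
    ultimately show ?thesis by blast
  qed
  have "norm (det X) = 1"
    by (rule norm_det_unitary) (use row in \<open>auto simp: cinner_self\<close>)
  then show ?thesis
    using max[of A] assms by (simp add: K_def)
qed

text \<open>Multilinearity reduces to rows of length 1; a zero row cannot be normalised but makes
  the determinant 0.\<close>

theorem hadamard_inequality:
  fixes A :: "complex ^ 'n ^ 'n::finite"
  shows "norm (det A) \<le> (\<Prod>i\<in>UNIV. norm (A $ i))"
proof (cases "\<exists>i. A $ i = 0")
  case True
  then obtain i where "row i A = 0" by (auto simp: row_def vec_eq_iff)
  then have "det A = 0" by (rule det_zero_row(1))
  then show ?thesis by (simp add: prod_nonneg)
next
  case False
  define X where "X = (\<chi> i. of_real (1 / norm (A $ i)) *s A $ i)"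
  have "norm (det X) \<le> 1"
    by (rule norm_det_le_1) (use False in \<open>simp add: X_def norm_smult_vec norm_divide\<close>)
  moreover have "A = (\<chi> i. of_real (norm (A $ i)) *s X $ i)"
    using False by (simp add: X_def vec_eq_iff)
  then have "det A = (\<Prod>i\<in>UNIV. of_real (norm (A $ i))) * det X"
    using det_rows_mul[of "\<lambda>i. of_real (norm (A $ i))" "\<lambda>i. X $ i"] by simp
  then have "norm (det A) = (\<Prod>i\<in>UNIV. norm (A $ i)) * norm (det X)"
    by (simp add: norm_mult prod_norm[symmetric])
  ultimately show ?thesis
    by (simp add: mult_left_le prod_nonneg)
qed

lemma prod_le_mean_power:
  fixes x :: "'a \<Rightarrow> real"
  assumes "finite S" "S \<noteq> {}" "\<And>i. i \<in> S \<Longrightarrow> x i \<ge> 0"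
  shows "(\<Prod>i\<in>S. x i) \<le> ((\<Sum>i\<in>S. x i) / card S) ^ card S"
proof -
  have n: "card S > 0" using assms by (simp add: card_gt_0_iff)
  have p: "(\<Prod>i\<in>S. x i) \<ge> 0" by (rule prod_nonneg) (use assms in auto)
  have "(\<Prod>i\<in>S. x i) = ((\<Prod>i\<in>S. x i) powr (1 / card S)) ^ card S"
    using n p by (cases "(\<Prod>i\<in>S. x i) = 0")
      (auto simp: powr_realpow[symmetric] powr_powr zero_power)
  also have "\<dots> \<le> (\<Sum>i\<in>S. x i / card S) ^ card S"
    by (intro power_mono arith_geom_mean assms) auto
  finally show ?thesis by (simp add: sum_divide_distrib)
qed

lemma norm_matrix_square:
  "(norm (A :: complex ^ 'n ^ 'm::finite))\<^sup>2 = (\<Sum>i\<in>UNIV. (norm (A $ i))\<^sup>2)"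
  by (simp add: norm_vec_def[of A] L2_set_def sum_nonneg)

text \<open>The norm of a nested vector is the Frobenius norm, so AM-GM on the squared row lengths
  removes the individual rows from Hadamard's bound.\<close>

corollary norm_det_square_le:
  fixes A :: "complex ^ 'n ^ 'n::finite"
  shows "(norm (det A))\<^sup>2 \<le> ((norm A)\<^sup>2 / CARD('n)) ^ CARD('n)"
proof -
  have "(norm (det A))\<^sup>2 \<le> (\<Prod>i\<in>UNIV. norm (A $ i))\<^sup>2"
    by (intro power_mono hadamard_inequality) auto
  also have "\<dots> = (\<Prod>i\<in>UNIV. (norm (A $ i))\<^sup>2)"
    by (simp add: prod_power_distrib)
  also have "\<dots> \<le> ((\<Sum>i\<in>UNIV. (norm (A $ i))\<^sup>2) / CARD('n)) ^ CARD('n)"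
    by (rule prod_le_mean_power) auto
  finally show ?thesis by (simp add: norm_matrix_square)
qed

section \<open>Condition numbers\<close>

text \<open>The matrix determinant lemma. When the rows of the identity are updated one at a time,
  linearity in row \<open>k\<close> adds \<open>u $ k\<close> times a determinant with
  \<open>w\<close> in that row.\<close>

lemma det_rank_one_update:
  fixes u w :: "'a::field ^ 'n::finite"
  shows "det (\<chi> i. axis i 1 + u $ i *s w) = 1 + (\<Sum>i\<in>UNIV. u $ i * w $ i)"
proof -
  define c where "c S i = (if i \<in> S then axis i 1 + u $ i *s w else axis i 1)" for S i
  \<comment> \<open>With \<open>w\<close> itself in row \<open>k\<close>, row operations clear its
    multiples from the other rows.\<close>
  have w: "det (\<chi> i. if i = k then w else c S i) = w $ k" if "finite S" "k \<notin> S" for S k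
    using that
  proof (induction S rule: finite_induct)
    case empty
    have "(\<chi> i. if i = k then w else c {} i) = transpose (\<chi> i j. if j = k then (mat 1 *v w) $ i else mat 1 $ i $ j)"
      unfolding matrix_vector_mul_lid
      by (simp add: c_def vec_eq_iff transpose_def mat_def axis_def)
    then show ?case
      by (simp only: det_transpose cramer_lemma det_I) simp
  next
    case (insert j S)
    let ?A = "\<chi> i. if i = k then w else c S i"
    have "(\<chi> i. if i = k then w else c (insert j S) i)
        = (\<chi> i. if i = j then row j ?A + u $ j *s row k ?A else row i ?A)"
      using insert by (auto simp: c_def vec_eq_iff row_def)
    then show ?case
      using insert det_row_operation[of j k ?A "u $ j"] by auto
  qed
  have "det (\<chi> i. c S i) = 1 + (\<Sum>i\<in>S. u $ i * w $ i)" if "finite S" for S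
    using that
  proof (induction S rule: finite_induct)
    case empty
    have "(\<chi> i. c {} i) = mat 1" by (simp add: c_def vec_eq_iff mat_def axis_def)
    then show ?case by simp
  next
    case (insert k S)
    have "(\<chi> i. c (insert k S) i) = (\<chi> i. if i = k then axis i 1 + u $ k *s w else c S i)"
      by (simp add: c_def vec_eq_iff)
    then have "det (\<chi> i. c (insert k S) i) = det (\<chi> i. if i = k then axis i 1 else c S i)
        + u $ k * det (\<chi> i. if i = k then w else c S i)"
      by (simp only: det_row_add det_row_mul)
    also have "(\<chi> i. if i = k then axis i 1 else c S i) = (\<chi> i. c S i)"
      using insert by (simp add: c_def vec_eq_iff)
    finally show ?case using insert w[of S k] by simp
  qed
  from this[of UNIV] show ?thesis by (simp add: c_def)
qed

text \<open>This is A (I + (t - 1) v v^H), with v^H the conjugate transpose. For a unit vector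
  \<open>v\<close> it scales the action of \<open>A\<close> on \<open>v\<close> by \<open>t\<close>
  and keeps its action on the orthogonal complement.\<close>

definition stretch :: "complex ^ 'n ^ 'n::finite \<Rightarrow> real \<Rightarrow> complex ^ 'n \<Rightarrow> complex ^ 'n ^ 'n" where
  "stretch A t v = (\<chi> i. A $ i + (of_real (t - 1) * (A *v v) $ i) *s (\<chi> j. cnj (v $ j)))"

lemma det_stretch:
  assumes "norm v = 1"
  shows "det (stretch A t v) = of_real t * det A"
proof -
  let ?K = "\<chi> i. axis i 1 + (of_real (t - 1) *s v) $ i *s (\<chi> j. cnj (v $ j))"
  have "stretch A t v = A ** ?K"
    by (simp add: stretch_def vec_eq_iff matrix_matrix_mult_def matrix_vector_mult_def axis_def
        distrib_left sum.distrib sum_distrib_left sum_distrib_right mult_delta_right mult_ac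
        del: of_real_diff)
  moreover have "det ?K = 1 + of_real (t - 1) * cinner v v"
    unfolding det_rank_one_update by (simp add: cinner_def sum_distrib_left algebra_simps)
  ultimately show ?thesis
    using assms by (simp add: det_mul cinner_self mult.commute)
qed

text \<open>In each row only the component along the conjugate of \<open>v\<close> is scaled by
  \<open>t\<close>; its coefficient is the matching entry of \<open>A *v v\<close>.\<close>

lemma norm_stretch_square:
  assumes "norm v = 1"
  shows "(norm (stretch A t v))\<^sup>2 = (norm A)\<^sup>2 + (t\<^sup>2 - 1) * (norm (A *v v))\<^sup>2"
proof -
  let ?w = "\<chi> j. cnj (v $ j)"
  have "norm ?w = 1"
    using assms by (simp add: norm_vec_def L2_set_def)
  have row: "(norm (stretch A t v $ i))\<^sup>2 = (norm (A $ i))\<^sup>2 + (t\<^sup>2 - 1) * (norm ((A *v v) $ i))\<^sup>2" for i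
  proof -
    let ?y = "(A *v v) $ i"
    have "cinner (A $ i) ?w = ?y"
      by (simp add: cinner_def matrix_vector_mult_def)
    then have "(norm (stretch A t v $ i))\<^sup>2 = (norm (A $ i))\<^sup>2
        + 2 * Re (of_real (t - 1) * (?y * cnj ?y)) + (t - 1)\<^sup>2 * (norm ?y)\<^sup>2"
      unfolding stretch_def vec_lambda_beta norm_add_smult_square \<open>norm ?w = 1\<close>
      by (simp add: norm_mult power_mult_distrib mult_ac del: of_real_diff)
    also have "?y * cnj ?y = of_real ((norm ?y)\<^sup>2)"
      by (simp only: complex_norm_square)
    finally show ?thesis
      by (simp add: power2_eq_square algebra_simps)
  qed
  show ?thesis
    by (simp add: norm_matrix_square row sum.distrib norm_vec_def[of "A *v v"] L2_set_def sum_nonneg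
        flip: sum_distrib_left)
qed

lemma stretch_mult_vec:
  "stretch A t v *v x = A *v x + (of_real (t - 1) * cinner x v) *s (A *v v)"
proof -
  define y where "y = A *v v"
  show ?thesis
    unfolding stretch_def y_def[symmetric]
    by (simp add: vec_eq_iff matrix_vector_mult_def cinner_def distrib_left sum.distrib
        sum_distrib_left sum_distrib_right mult_ac)
qed

section \<open>Extremal vectors of the operator norm\<close>

lemma onorm_attained:
  fixes f :: "'a::euclidean_space \<Rightarrow> 'b::real_normed_vector"
  assumes "bounded_linear f"
  obtains v where "norm v = 1" "norm (f v) = onorm f"
proof -
  have "continuous_on (sphere 0 1) (\<lambda>v. norm (f v))"
    by (intro continuous_on_norm bounded_linear.continuous_on[OF assms] continuous_intros)
  moreover obtain b :: 'a where "norm b = 1"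
    using norm_Basis nonempty_Basis by blast
  then have "sphere (0::'a) 1 \<noteq> {}" by auto
  ultimately obtain v where v: "v \<in> sphere 0 1"
    and max: "\<And>x. x \<in> sphere 0 1 \<Longrightarrow> norm (f x) \<le> norm (f v)"
    using continuous_attains_sup[of "sphere 0 1" "\<lambda>v. norm (f v)"] by auto
  interpret bounded_linear f by fact
  have "norm (f x) \<le> norm (f v) * norm x" for x
  proof (cases "x = 0")
    case False
    then have "norm (f (x /\<^sub>R norm x)) \<le> norm (f v)" by (intro max) simp
    then show ?thesis using False by (simp add: scale field_simps)
  qed (simp add: zero)
  then have "onorm f \<le> norm (f v)" by (intro onorm_bound) auto
  moreover have "norm (f v) \<le> onorm f" using onorm[OF assms, of v] v by simp
  ultimately show ?thesis using v by (intro that[of v]) auto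
qed

text \<open>Perturbing \<open>v\<close> by a multiple of \<open>w\<close> changes its length only to
  second order, but could increase the length of the image to first order if the images were not
  orthogonal.\<close>

lemma maximal_vector_orthogonal:
  fixes A :: "complex ^ 'n ^ 'n::finite"
  assumes v: "norm v = 1" "norm (A *v v) = onorm ((*v) A)" and w: "cinner v w = 0"
  shows "cinner (A *v v) (A *v w) = 0"
proof (rule ccontr)
  define z where "z = cinner (A *v v) (A *v w)"
  define s where "s = onorm ((*v) A)"
  assume "cinner (A *v v) (A *v w) \<noteq> 0"
  then have z: "norm z > 0" by (simp add: z_def)
  \<comment> \<open>\<open>r\<close> keeps the second-order term below
    \<open>r * (norm z)\<^sup>2\<close>, while \<open>c\<close>, pointing along \<open>z\<close>,
    gains twice that amount to first order.\<close>
  define r where "r = 1 / (1 + s\<^sup>2 * (norm w)\<^sup>2)"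
  have pos: "1 + s\<^sup>2 * (norm w)\<^sup>2 > 0" by (simp add: add_pos_nonneg)
  then have r: "r > 0" by (simp add: r_def)
  define c where "c = of_real r * z"
  have "cnj c * z = of_real (r * (norm z)\<^sup>2)"
    by (simp add: c_def mult_ac flip: complex_norm_square)
  then have "(norm (A *v v + c *s (A *v w)))\<^sup>2
      = s\<^sup>2 + 2 * (r * (norm z)\<^sup>2) + (norm c)\<^sup>2 * (norm (A *v w))\<^sup>2"
    unfolding norm_add_smult_square by (simp add: v s_def flip: z_def)
  moreover have "(norm (A *v v + c *s (A *v w)))\<^sup>2 = (norm (A *v (v + c *s w)))\<^sup>2"
    by (simp add: matrix_vector_right_distrib vector_scalar_commute)
  moreover have "(norm (A *v (v + c *s w)))\<^sup>2 \<le> (s * norm (v + c *s w))\<^sup>2"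
    unfolding s_def by (intro power_mono onorm matrix_vector_mul_bounded_linear) auto
  moreover have "(s * norm (v + c *s w))\<^sup>2 = s\<^sup>2 + s\<^sup>2 * (norm c)\<^sup>2 * (norm w)\<^sup>2"
    unfolding power_mult_distrib norm_add_smult_square by (simp add: v w algebra_simps)
  moreover have "(norm c)\<^sup>2 * (norm (A *v w))\<^sup>2 \<ge> 0" by simp
  ultimately have "2 * (r * (norm z)\<^sup>2) \<le> s\<^sup>2 * (norm c)\<^sup>2 * (norm w)\<^sup>2"
    by linarith
  also have "\<dots> = (r * (norm z)\<^sup>2) * (r * (s\<^sup>2 * (norm w)\<^sup>2))"
    by (simp add: c_def norm_mult power2_eq_square)
  finally have "2 \<le> r * (s\<^sup>2 * (norm w)\<^sup>2)"
    using r z by (simp add: mult_le_cancel_left_pos mult.commute[of 2])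
  also have "\<dots> < 1"
    using pos by (simp add: r_def field_simps)
  finally show False by simp
qed

text \<open>
  The bound of Guggenheimer, Edelman and Johnson. Its usual proof applies AM-GM to the squared
  singular values with \<open>\<sigma>\<^sub>1\<^sup>2\<close> split into two halves and the smallest one
  dropped. Here the same effect is obtained from \<open>norm_det_square_le\<close> by shrinking \<open>A\<close>
  by \<open>1 / sqrt 2\<close> along a maximal vector and stretching it by \<open>\<sigma>\<^sub>1 / (sqrt 2 \<sigma>\<^sub>n)\<close>
  along a minimal one.
\<close>

theorem condition_number_bound:
  fixes A :: "complex ^ 'n ^ 'n::finite"
  assumes "invertible A"
  shows "(onorm ((*v) A))\<^sup>2 * (onorm ((*v) (matrix_inv A)))\<^sup>2 * (norm (det A))\<^sup>2
    < 4 * ((norm A)\<^sup>2 / CARD('n)) ^ CARD('n)"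
proof -
  define s where "s = onorm ((*v) A)"
  define \<tau> where "\<tau> = onorm ((*v) (matrix_inv A))"
  obtain v where v: "norm v = 1" "norm (A *v v) = s"
    using onorm_attained[OF matrix_vector_mul_bounded_linear] unfolding s_def .
  obtain y where y: "norm y = 1" "norm (matrix_inv A *v y) = \<tau>"
    using onorm_attained[OF matrix_vector_mul_bounded_linear] unfolding \<tau>_def .
  have inv: "A *v (matrix_inv A *v x) = x" "matrix_inv A *v (A *v x) = x" for x
    using someI_ex[OF assms[unfolded invertible_def]]
    by (simp_all add: matrix_vector_mul_assoc flip: matrix_inv_def)
  have "\<tau> \<noteq> 0"
    using y inv(1)[of y] by auto
  then have \<tau>: "\<tau> > 0" using y by (smt (verit) norm_ge_zero)
  have s0: "s \<ge> 0" using v by (smt (verit) norm_ge_zero)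
  have lower: "norm x \<le> \<tau> * norm (A *v x)" for x
    using onorm[OF matrix_vector_mul_bounded_linear, of "matrix_inv A" "A *v x"] inv
    by (simp add: \<tau>_def)
  \<comment> \<open>\<open>1 / \<tau>\<close> is the least singular value, and \<open>u\<close> is a
    unit vector at which \<open>A\<close> attains it.\<close>
  define u where "u = of_real (1 / \<tau>) *s (matrix_inv A *v y)"
  have "A *v u = of_real (1 / \<tau>) *s y"
    unfolding u_def by (simp only: vector_scalar_commute inv)
  then have u: "norm u = 1" "norm (A *v u) = 1 / \<tau>"
    using \<tau> y by (simp_all add: u_def norm_smult_vec norm_divide)
  define F where "F = (norm A)\<^sup>2 / CARD('n)"
  have det0: "norm (det A) > 0" using assms by (simp add: invertible_det_nz)
  define a where "a = cinner u v"
  define w where "w = u + (- a) *s v"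
  \<comment> \<open>The extremal vectors are orthogonal unless \<open>A\<close> is a multiple of an
    isometry. Split \<open>u\<close> into \<open>w\<close> and its projection on \<open>v\<close>:
    the images stay orthogonal, and Pythagoras before and after applying \<open>A\<close> is
    compared through \<open>lower\<close>.\<close>
  have "s * \<tau> \<le> 1 \<or> a = 0"
  proof (rule disjCI)
    assume "a \<noteq> 0"
    have "cinner w v = 0"
      unfolding w_def cinner_add_left cinner_smult_left by (simp add: a_def cinner_self v)
    then have vw: "cinner v w = 0" using cinner_commute[of v w] by simp
    have orth: "cinner (A *v v) (A *v w) = 0"
      by (rule maximal_vector_orthogonal) (use v vw in \<open>simp_all add: s_def\<close>)
    have uw: "u = w + a *s v" by (simp add: w_def vec_eq_iff)
    have "1 = (norm w)\<^sup>2 + (norm a)\<^sup>2"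
      using norm_add_smult_square[of w a v] u v \<open>cinner w v = 0\<close> by (simp flip: uw)
    moreover have "A *v u = A *v w + a *s (A *v v)"
      by (simp add: uw matrix_vector_right_distrib vector_scalar_commute)
    then have "(1 / \<tau>)\<^sup>2 = (norm (A *v w))\<^sup>2 + (norm a)\<^sup>2 * s\<^sup>2"
      using norm_add_smult_square[of "A *v w" a "A *v v"] u v orth cinner_commute[of "A *v w" "A *v v"]
      by simp
    then have "1 = (\<tau> * norm (A *v w))\<^sup>2 + (norm a)\<^sup>2 * (s * \<tau>)\<^sup>2"
      using \<tau> by (simp add: field_simps power2_eq_square)
    moreover have "(norm w)\<^sup>2 \<le> (\<tau> * norm (A *v w))\<^sup>2"
      by (intro power_mono lower) auto
    ultimately have "(norm a)\<^sup>2 * (s * \<tau>)\<^sup>2 \<le> (norm a)\<^sup>2 * 1" by simp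
    then have "(s * \<tau>)\<^sup>2 \<le> 1"
      by (rule mult_left_le_imp_le) (use \<open>a \<noteq> 0\<close> in simp)
    then show "s * \<tau> \<le> 1"
      using power2_le_imp_le[of "s * \<tau>" 1] by simp
  qed
  then show ?thesis
  proof
    assume st: "s * \<tau> \<le> 1"
    have "s\<^sup>2 * \<tau>\<^sup>2 * (norm (det A))\<^sup>2 = (s * \<tau>)\<^sup>2 * (norm (det A))\<^sup>2"
      by (simp add: power_mult_distrib)
    also have "\<dots> \<le> 1 * (norm (det A))\<^sup>2"
      using st s0 \<tau> by (intro mult_right_mono power_le_one) auto
    also have "\<dots> < 4 * (norm (det A))\<^sup>2" using det0 by simp
    also have "\<dots> \<le> 4 * F ^ CARD('n)"
      using norm_det_square_le[of A] by (simp add: F_def)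
    finally show ?thesis by (simp add: s_def \<tau>_def F_def)
  next
    assume "a = 0"
    \<comment> \<open>The squared factors 1/2 and \<open>(s * \<tau>)\<^sup>2 / 2\<close> multiply
      to the condition number over 4. As \<open>u\<close> is orthogonal to \<open>v\<close>, the
      changes of the squared Frobenius norm add up to \<open>- (1 / \<tau>)\<^sup>2\<close>, whence
      strictness.\<close>
    define A1 where "A1 = stretch A (sqrt (1 / 2)) v"
    define A2 where "A2 = stretch A1 (sqrt ((s * \<tau>)\<^sup>2 / 2)) u"
    have "A1 *v u = A *v u"
      using \<open>a = 0\<close> by (simp add: A1_def stretch_mult_vec a_def)
    then have "(norm A2)\<^sup>2 = (norm A)\<^sup>2 + (1 / 2 - 1) * s\<^sup>2 + ((s * \<tau>)\<^sup>2 / 2 - 1) * (1 / \<tau>)\<^sup>2"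
      unfolding A2_def norm_stretch_square[OF u(1)] by (simp add: A1_def norm_stretch_square v u)
    also have "\<dots> = (norm A)\<^sup>2 - (1 / \<tau>)\<^sup>2"
      using \<tau> by (simp add: field_simps power2_eq_square)
    finally have "(norm A2)\<^sup>2 < (norm A)\<^sup>2" using \<tau> by simp
    then have "((norm A2)\<^sup>2 / CARD('n)) ^ CARD('n) < F ^ CARD('n)"
      unfolding F_def by (intro power_strict_mono[where n = "CARD('n)"] divide_strict_right_mono) auto
    moreover have "(norm (det A2))\<^sup>2 = (s * \<tau>)\<^sup>2 * (norm (det A))\<^sup>2 / 4"
      by (simp add: A2_def A1_def det_stretch u v norm_mult power_mult_distrib)
    ultimately show ?thesis
      using norm_det_square_le[of A2] by (simp add: s_def \<tau>_def F_def power_mult_distrib)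
  qed
qed

section \<open>Character matrices\<close>

lemma ipoly_det:
  fixes P :: "int poly ^ 'n ^ 'n::finite"
  shows "ipoly (det P) r = det (\<chi> i j. ipoly (P $ i $ j) r)"
  by (simp add: Determinants.det_def hom_distribs poly_sum poly_prod)

lemma norm_unimodular_matrix_square:
  fixes A :: "complex ^ 'n ^ 'n::finite"
  assumes "\<And>i j. norm (A $ i $ j) = 1"
  shows "(norm A)\<^sup>2 = (real CARD('n))\<^sup>2"
  unfolding norm_matrix_square
  by (simp add: assms norm_vec_def L2_set_def power2_eq_square)

lemma norm_root_of_unity:
  fixes z :: complex
  assumes "M > 0" "z ^ M = 1"
  shows "norm z = 1"
proof -
  have "norm z ^ M = 1 ^ M" using assms(2) by (metis norm_one norm_power power_one)
  then show ?thesis by (rule power_eq_imp_eq_base) (use assms(1) in auto)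
qed

lemma det_root_of_unity_matrix_ge:
  fixes A :: "complex ^ 'n ^ 'n::finite"
  assumes M: "M > 0" and A: "\<And>i j. (A $ i $ j) ^ M = 1" and "invertible A"
  shows "1 \<le> norm (det A) * sqrt (real CARD('n) ^ CARD('n)) ^ (totient M - 1)"
proof -
  let ?n = "CARD('n)"
  define z where "z = cis (2 * pi / real M)"
  have "\<exists>k. A $ i $ j = z ^ k" for i j
  proof -
    have "A $ i $ j \<in> (\<lambda>k. cis (2 * pi * real k / real M)) ` {..<M}"
      using A[of i j] Complex.bij_betw_roots_unity[OF M] by (auto simp: bij_betw_def)
    then obtain k where "A $ i $ j = cis (2 * pi * real k / real M)" by auto
    then have "A $ i $ j = z ^ k" by (simp add: z_def Complex.DeMoivre mult.commute)
    then show ?thesis ..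
  qed
  then obtain e where e: "\<And>i j. A $ i $ j = z ^ e i j" by metis
  \<comment> \<open>Replacing \<open>z\<close> by an indeterminate gives one integer polynomial
    whose value at any \<open>M\<close>-th root of unity is again a determinant with unimodular
    entries.\<close>
  define p :: "int poly" where "p = det (\<chi> i j. monom 1 (e i j))"
  have p: "ipoly p r = det (\<chi> i j. r ^ e i j)" for r
    by (simp add: p_def ipoly_det poly_monom)
  have "(\<chi> i j. z ^ e i j) = A" by (simp add: e vec_eq_iff)
  then have pz: "ipoly p z = det A" by (simp add: p)
  have "norm (ipoly p r) \<le> sqrt (real ?n ^ ?n)" if r: "r ^ M = 1" for r
  proof -
    let ?R = "(\<chi> i j. r ^ e i j) :: complex ^ 'n ^ 'n"
    have "norm r = 1" using M r by (rule norm_root_of_unity)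
    then have "(norm ?R)\<^sup>2 = (real ?n)\<^sup>2"
      by (intro norm_unimodular_matrix_square) (simp add: norm_power)
    then have "(norm (det ?R))\<^sup>2 \<le> real ?n ^ ?n"
      using norm_det_square_le[of ?R] by (simp add: power2_eq_square)
    then show ?thesis by (simp add: p real_le_rsqrt)
  qed
  then show ?thesis
    using norm_ipoly_root_of_unity_ge[of M p "sqrt (real ?n ^ ?n)"] M pz \<open>invertible A\<close>
    by (simp add: invertible_det_nz flip: z_def)
qed

section \<open>Characters of products of cyclic groups\<close>

lemma pow_product_group:
  "x \<in> carrier (product_group I G) \<Longrightarrow> (\<And>i. i \<in> I \<Longrightarrow> group (G i)) \<Longrightarrow>
    x [^]\<^bsub>product_group I G\<^esub> (n :: nat) = (\<lambda>i\<in>I. x i [^]\<^bsub>G i\<^esub> n)"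
proof (induction n)
  case (Suc n)
  then show ?case by (auto simp: fun_eq_iff restrict_def)
qed (auto simp: fun_eq_iff)

text \<open>A common multiple of the \<open>N i\<close> annihilates \<open>G\<close>, so the
  \<open>M\<close>-th power of a character value is its value at the identity.\<close>

lemma character_root_of_unity:
  assumes G: "G = product_group I (\<lambda>i. integer_mod_group (N i))"
    and M: "\<And>i. i \<in> I \<Longrightarrow> N i dvd M"
    and g: "g \<in> carrier G" and \<psi>: "\<psi> \<in> carrier (character_group G)"
  shows "\<psi> g ^ M = 1"
proof -
  have "group G" unfolding G by (rule product_group) simp
  then interpret group G .
  have mult: "\<psi> (a \<otimes>\<^bsub>G\<^esub> b) = \<psi> a * \<psi> b" and nonzero: "\<psi> a \<noteq> 0"
    if "a \<in> carrier G" "b \<in> carrier G" for a b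
    using \<psi> that by (force simp: character_group_def circle_group_def hom_def Pi_iff)+
  have one: "\<psi> \<one>\<^bsub>G\<^esub> = 1"
    using mult[of "\<one>\<^bsub>G\<^esub>" "\<one>\<^bsub>G\<^esub>"] nonzero[of "\<one>\<^bsub>G\<^esub>"] by auto
  have pow: "\<psi> (g [^]\<^bsub>G\<^esub> k) = \<psi> g ^ k" for k :: nat
    by (induction k) (simp_all add: one mult g)
  have "g [^]\<^bsub>G\<^esub> M = \<one>\<^bsub>G\<^esub>"
    using g M unfolding G by (subst pow_product_group) (auto simp: fun_eq_iff)
  then show ?thesis using pow[of M] one by simp
qed

theorem theorem5p8:
  fixes l n M :: nat and N :: "nat \<Rightarrow> nat"
    and G :: "(nat \<Rightarrow> int) monoid"
    and E :: "(nat \<Rightarrow> int) set" and B :: "((nat \<Rightarrow> int) \<Rightarrow> complex) set"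
    and x :: "'n::finite \<Rightarrow> nat \<Rightarrow> int" and b :: "'n \<Rightarrow> (nat \<Rightarrow> int) \<Rightarrow> complex"
  assumes "\<And>i. i \<in> {1..l} \<Longrightarrow> N i \<ge> 1"
    and "G = product_group {1..l} (\<lambda>i. integer_mod_group (N i))"
    and "M = Lcm (N ` {1..l})"
    and "E \<subseteq> carrier G" and "card E = n"
    and "B \<subseteq> carrier (character_group G)"
    and "bij_betw x UNIV E" and "bij_betw b UNIV B"
    and "basis_pair x b"
  shows "abs_det x b \<ge> real n powr (real n * (1 - real (totient M)) / 2)
       \<and> cond_sq x b < ereal (4 * real n ^ (n * totient M))"
proof -
  define A where "A = eval_matrix x b"
  define D where "D = norm (det A)"
  define \<phi> where "\<phi> = totient M"
  have n: "n = CARD('n)"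
    using assms(5) bij_betw_same_card[OF assms(7)] by simp
  then have n0: "n > 0" by simp
  \<comment> \<open>All moduli are positive; for l = 0 the lcm of the empty set is 1.\<close>
  have "M \<noteq> 0"
    using assms(1) unfolding assms(3) by (subst Lcm_0_iff_nat) force+
  then have M: "M > 0" by simp
  then have \<phi>: "\<phi> \<ge> 1" by (simp add: \<phi>_def Suc_le_eq)
  have inv: "invertible A" using assms(9) by (simp add: basis_pair_def A_def)
  have root: "(A $ i $ j) ^ M = 1" for i j
  proof -
    have "x i \<in> carrier G" using assms(4,7) by (auto simp: bij_betw_def)
    moreover have "b j \<in> carrier (character_group G)" using assms(6,8) by (auto simp: bij_betw_def)
    moreover have "N i dvd M" if "i \<in> {1..l}" for i using that unfolding assms(3) by (intro dvd_Lcm) auto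
    ultimately have "b j (x i) ^ M = 1"
      by (intro character_root_of_unity[OF assms(2)])
    then show ?thesis by (simp add: A_def eval_matrix_def)
  qed
  have "norm (A $ i $ j) = 1" for i j
    using M root by (rule norm_root_of_unity)
  then have normA: "(norm A)\<^sup>2 = (real n)\<^sup>2" unfolding n by (rule norm_unimodular_matrix_square)
  have D: "1 \<le> D * sqrt (real n ^ n) ^ (\<phi> - 1)"
    unfolding D_def \<phi>_def n by (rule det_root_of_unity_matrix_ge[OF M root inv])
  have "sqrt (real n ^ n) = real n powr (real n / 2)"
    using n0 by (simp add: powr_half_sqrt[symmetric] powr_realpow[symmetric] powr_powr)
  then have "sqrt (real n ^ n) ^ (\<phi> - 1) = real n powr (real n / 2 * real (\<phi> - 1))"
    using n0 by (simp add: powr_realpow[symmetric] powr_powr)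
  \<comment> \<open>\<open>\<phi> \<ge> 1\<close> makes the truncated \<open>\<phi> - 1\<close> a
    true difference.\<close>
  also have "\<dots> = real n powr - (real n * (1 - real \<phi>) / 2)"
    using \<phi> by (simp add: of_nat_diff algebra_simps diff_divide_distrib)
  finally have "1 \<le> D / real n powr (real n * (1 - real \<phi>) / 2)"
    using D by (simp only: powr_minus_divide) simp
  then have "D \<ge> real n powr (real n * (1 - real \<phi>) / 2)"
    using n0 by (simp add: pos_le_divide_eq)
  moreover have "(onorm ((*v) A))\<^sup>2 * (onorm ((*v) (matrix_inv A)))\<^sup>2 < 4 * real n ^ (n * \<phi>)"
  proof -
    define \<rho> where "\<rho> = (onorm ((*v) A))\<^sup>2 * (onorm ((*v) (matrix_inv A)))\<^sup>2"
    \<comment> \<open>The squared determinant bound, multiplied by \<open>\<rho>\<close>, produces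
      the factor \<open>D\<^sup>2\<close> that \<open>condition_number_bound\<close> requires. Its
      right side is 4 n^n, because the squared Frobenius norm divided by n is n.\<close>
    have "1 \<le> (D * sqrt (real n ^ n) ^ (\<phi> - 1))\<^sup>2" using D by (simp add: one_le_power)
    also have "\<dots> = D\<^sup>2 * (real n ^ n) ^ (\<phi> - 1)"
      by (simp add: power_mult_distrib power_mult[symmetric] mult.commute[of _ 2]) (simp add: power_mult)
    finally have "\<rho> * 1 \<le> \<rho> * (D\<^sup>2 * (real n ^ n) ^ (\<phi> - 1))"
      by (intro mult_left_mono) (simp_all add: \<rho>_def)
    also have "\<dots> = \<rho> * D\<^sup>2 * (real n ^ n) ^ (\<phi> - 1)" by simp
    also have "\<dots> < 4 * real n ^ n * (real n ^ n) ^ (\<phi> - 1)"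
      using condition_number_bound[OF inv] n0 normA
      by (intro mult_strict_right_mono) (simp_all add: \<rho>_def D_def power2_eq_square flip: n)
    also have "\<dots> = 4 * (real n ^ n) ^ Suc (\<phi> - 1)" by simp
    also have "Suc (\<phi> - 1) = \<phi>" using \<phi> by simp
    finally show ?thesis by (simp add: \<rho>_def power_mult)
  qed
  ultimately show ?thesis
    using inv by (simp add: abs_det_def cond_sq_def D_def \<phi>_def flip: A_def)
qed

end
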